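(* Let $S \in L^{1}(\mathbb{R})$ and let $[a,b] \subset \mathbb{R}$ be a compact interval such that $S \in C^{m}([a,b])$ and $S^{(m+1)}$ exists and is bounded on $(a,b)$. Suppose that $m,k \geq 2$ are integers and let $q \leq \min\{m,k\} - 1$ be the degree of exactness of the closed Newton-Cotes quadrature rule used, in composite form on the points $a = \xi_{0} < \xi_{1} < \cdots < \xi_{N_{p}} = b$ with $h_{i} = (\xi_{i+1}-\xi_{i})/q$, to compute the approximation $\tilde{S}^{m,k}_{\varepsilon}$ of the convolution $S^{m,k}_{\varepsilon} = S \ast \delta^{m,k}_{\varepsilon}$. Then $$S(x) - \tilde{S}^{m,k}_{\varepsilon}(x) = \mathcal{O}(\varepsilon^{m+1}) \quad \text{for } x \in (a + \varepsilon , b - \varepsilon),$$ provided that the (optimal) scaling parameter satisfies $$\varepsilon = \mathcal{O}\left(\left( \sum_{i=0}^{N_{p}-1} h_{i}^{q+2} \right)^{1/(m+q+3)}\right).$$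
   Context: For integers $m \geq 1$ and $k \geq 0$, let $P^{m,k}:[-1,1]\to\mathbb{R}$ be the polynomial of degree $2\left(\lfloor m/2 \rfloor + k + 1\right)$ uniquely determined by the conditions (1) $\int_{-1}^{1} P^{m,k}(\xi)\,\mathrm{d}\xi = 1$; (2) $(P^{m,k})^{(i)}(\pm 1) = 0$ for $i = 0,\ldots,k$; (3) $\int_{-1}^{1} \xi^{i} P^{m,k}(\xi)\,\mathrm{d}\xi = 0$ for $i = 1,\ldots,m$. It contains only even powers of $\xi$. For $\varepsilon > 0$ define $$\delta^{m,k}_{\varepsilon}(x) = \begin{cases} \dfrac{1}{\varepsilon} P^{m,k}\!\left(\dfrac{x}{\varepsilon}\right), & |x| \leq \varepsilon,\\ 0, & |x| > \varepsilon, \end{cases}$$ and $$S^{m,k}_{\varepsilon}(x) = (S \ast \delta^{m,k}_{\varepsilon})(x) = \int_{\mathbb{R}} S(\xi)\,\delta^{m,k}_{\varepsilon}(x-\xi)\,\mathrm{d}\xi = \int_{x-\varepsilon}^{x+\varepsilon} S(\xi)\,\delta^{m,k}_{\varepsilon}(x-\xi)\,\mathrm{d}\xi .$$ The composite closed Newton-Cotes approximation on the $N_{p}$ subintervals $[\xi_{i},\xi_{i+1}]$, $i=0,\ldots,N_{p}-1$, is $$\tilde{S}^{m,k}_{\varepsilon}(x) = \sum_{i = 0}^{N_{p} - 1} \sum_{j = 0}^{q} \alpha_{ij}\,S(\xi_{i} + j h_{i})\, \delta^{m,k}_{\varepsilon}(x - \xi_{i} - j h_{i}),$$ where $q$ is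 a nonnegative integer denoting the degree of exactness of the quadrature rule, $h_{i} = (\xi_{i+1}-\xi_{i})/q$, and $\alpha_{ij}$ are the Newton-Cotes weights on $[\xi_{i},\xi_{i+1}]$. Its quadrature error is taken in the form $$S^{m,k}_{\varepsilon}(x) - \tilde{S}^{m,k}_{\varepsilon}(x) = \kappa \sum_{i=0}^{N_{p}-1} h_{i}^{q+2}\, \frac{\partial^{q+1}}{\partial \xi^{q+1}}\Bigl(S(\xi)\,\delta^{m,k}_{\varepsilon}(x-\xi)\Bigr)\Big|_{\xi=\zeta_{i}},$$ with $\zeta_{i} \in (\xi_{i},\xi_{i+1})$ and $\kappa$ a constant independent of the integrand and of the $h_{i}$.
   Formalization: The condition ε = O((Σ h_i^{q+2})^{1/(m+q+3)}) is read as "of exactly that order" (upper and lower bound), since with only the upper bound the claim fails (fixed mesh, ε → 0, x not a node); q ≥ 1 is required so that h_i is defined. *)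

theory Defs
  imports
    "HOL-Analysis.Analysis"
    "HOL-Computational_Algebra.Polynomial"
    "HOL-Library.Landau_Symbols"
begin

text \<open>Derivatives are taken within the set \<open>I\<close>, hence one-sided at the end points of a
  compact interval; the values of \<open>f\<close> outside \<open>I\<close> play no role on \<open>I\<close>.\<close>

definition nth_deriv_on :: "real set \<Rightarrow> nat \<Rightarrow> (real \<Rightarrow> real) \<Rightarrow> real \<Rightarrow> real" where
  "nth_deriv_on I n f = ((\<lambda>g t. vector_derivative g (at t within I)) ^^ n) f"

definition continuously_differentiable_on :: "nat \<Rightarrow> (real \<Rightarrow> real) \<Rightarrow> real set \<Rightarrow> bool" where
  "continuously_differentiable_on n f I \<longleftrightarrow>
     (\<forall>j<n. nth_deriv_on I j f differentiable_on I) \<and> continuous_on I (nth_deriv_on I n f)"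

definition delta_poly :: "nat \<Rightarrow> nat \<Rightarrow> real poly" where
  "delta_poly m k = (THE p.
     degree p = 2 * (m div 2 + k + 1) \<and>
     integral {-1..1} (poly p) = 1 \<and>
     (\<forall>i\<le>k. poly ((pderiv ^^ i) p) 1 = 0 \<and> poly ((pderiv ^^ i) p) (-1) = 0) \<and>
     (\<forall>i\<in>{1..m}. integral {-1..1} (\<lambda>t. t ^ i * poly p t) = 0))"

definition delta :: "nat \<Rightarrow> nat \<Rightarrow> real \<Rightarrow> real \<Rightarrow> real" where
  "delta m k \<epsilon> x = (if \<bar>x\<bar> \<le> \<epsilon> then (1 / \<epsilon>) * poly (delta_poly m k) (x / \<epsilon>) else 0)"

text \<open>A subdivision of \<open>[a, b]\<close> into \<open>N\<close> subintervals is given by the values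
  \<open>\<xi> 0, \<dots>, \<xi> N\<close>; later values of \<open>\<xi>\<close> are irrelevant.\<close>

definition subdivision :: "real \<Rightarrow> real \<Rightarrow> nat \<Rightarrow> (nat \<Rightarrow> real) \<Rightarrow> bool" where
  "subdivision a b N \<xi> \<longleftrightarrow> \<xi> 0 = a \<and> \<xi> N = b \<and> (\<forall>i<N. \<xi> i < \<xi> (Suc i))"

definition nc_step :: "nat \<Rightarrow> (nat \<Rightarrow> real) \<Rightarrow> nat \<Rightarrow> real" where
  "nc_step q \<xi> i = (\<xi> (Suc i) - \<xi> i) / real q"

definition nc_node :: "nat \<Rightarrow> (nat \<Rightarrow> real) \<Rightarrow> nat \<Rightarrow> nat \<Rightarrow> real" where
  "nc_node q \<xi> i j = \<xi> i + real j * nc_step q \<xi> i"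

text \<open>The Newton--Cotes weights are the integrals of the Lagrange basis polynomials
  of the \<open>q + 1\<close> equispaced nodes (end points included) of the subinterval; the rule is therefore
  exact on polynomials of degree at most \<open>q\<close>.\<close>

definition nc_weight :: "nat \<Rightarrow> (nat \<Rightarrow> real) \<Rightarrow> nat \<Rightarrow> nat \<Rightarrow> real" where
  "nc_weight q \<xi> i j = integral {\<xi> i..\<xi> (Suc i)}
     (\<lambda>t. \<Prod>l\<in>{0..q} - {j}. (t - nc_node q \<xi> i l) / (nc_node q \<xi> i j - nc_node q \<xi> i l))"

text \<open>The composite closed Newton--Cotes rule applied to the integrand
  \<open>\<lambda>t. S t * delta m k \<epsilon> (x - t)\<close> of the convolution of \<open>S\<close> with \<open>delta m k \<epsilon>\<close> at \<open>x\<close>.\<close>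

definition nc_convolution ::
  "nat \<Rightarrow> nat \<Rightarrow> nat \<Rightarrow> nat \<Rightarrow> (nat \<Rightarrow> real) \<Rightarrow> (real \<Rightarrow> real) \<Rightarrow> real \<Rightarrow> real \<Rightarrow> real" where
  "nc_convolution m k q N \<xi> S \<epsilon> x =
     (\<Sum>i<N. \<Sum>j=0..q. nc_weight q \<xi> i j * S (nc_node q \<xi> i j) * delta m k \<epsilon> (x - nc_node q \<xi> i j))"

end

theory Submission
  imports Defs
begin

text \<open>
  Insert the exact convolution between \<open>S (x i)\<close> and its quadrature approximation. The error
  splits into the error of the regularisation and the error of the Newton--Cotes rule.

  The regularisation error (\<open>regularisation_error\<close>) is \<open>O(\<epsilon> ^ (m + 1))\<close>: expand \<open>S\<close> at \<open>x\<close> to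
  order \<open>m\<close>; the kernel has mean one and vanishing moments up to order \<open>m\<close>, so only the remainder
  survives. For this one must know that the kernel polynomial has its defining properties, that is,
  that the conditions determine a polynomial of exactly the prescribed degree. Uniqueness
  (\<open>eq_0_if_moments_eq_0\<close>) comes from the positivity of the weight \<open>(1 - t\<^sup>2) ^ (k + 1)\<close>.
  Existence (\<open>ex_kernel_poly\<close>) comes from a Rodrigues formula: up to a factor, the polynomial is
  the derivative of order \<open>2 * M + 1\<close> of \<open>(t\<^sup>2 - 1) ^ (2 * M + k + 2)\<close>, divided by \<open>t\<close>, where
  \<open>M = m div 2\<close>.

  The quadrature error (\<open>quadrature_error\<close>) is governed by the derivative of order \<open>q + 1\<close> of the
  integrand \<open>\<lambda>t. S t * delta m k \<epsilon> (x - t)\<close>. The kernel is \<open>k\<close> times differentiable, also at the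
  ends of its support, so by the Leibniz rule (\<open>DERIV_integrand_deriv\<close>, \<open>integrand_deriv_bound\<close>)
  this derivative exists and is \<open>O(1 / \<epsilon> ^ (q + 2))\<close>. A Newton--Cotes rule is exact on the Taylor
  polynomial of degree \<open>q\<close>, so on a subinterval with step \<open>h\<close> it errs by at most a
  multiple of \<open>h ^ (q + 2) / \<epsilon> ^ (q + 2)\<close> (\<open>nc_error\<close>). With \<open>H\<close> the sum of the
  \<open>h ^ (q + 2)\<close>, the total is \<open>O(H / \<epsilon> ^ (q + 2))\<close>, and the coupling of \<open>\<epsilon>\<close> with
  \<open>H powr (1 / (m + q + 3))\<close> is the one that makes this \<open>O(\<epsilon> ^ (m + 1))\<close> as well.
\<close>

section \<open>Integrals of polynomials over the reference interval\<close>

lemma integrable_poly: "poly (p :: real poly) integrable_on {c..d}"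
  by (intro integrable_continuous_real continuous_intros)

lemma integral_poly_pderiv:
  "integral {-1..1} (poly (pderiv p)) = poly p 1 - poly p (-1 :: real)"
proof -
  have "(poly (pderiv p) has_integral poly p 1 - poly p (-1)) {-1..1}"
    by (rule fundamental_theorem_of_calculus)
      (auto intro!: derivative_eq_intros
        simp: has_real_derivative_iff_has_vector_derivative [symmetric])
  then show ?thesis
    by (rule integral_unique)
qed

lemma integral_by_parts_poly:
  fixes f g :: "real poly"
  shows "integral {-1..1} (poly (f * pderiv g)) =
    poly f 1 * poly g 1 - poly f (-1) * poly g (-1) - integral {-1..1} (poly (pderiv f * g))"
proof -
  have "integral {-1..1} (poly (pderiv (f * g))) =
      integral {-1..1} (poly (f * pderiv g)) + integral {-1..1} (poly (pderiv f * g))"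
    by (subst integral_add [OF integrable_poly integrable_poly, symmetric])
      (auto simp: pderiv_mult intro: integral_cong)
  then show ?thesis
    by (simp add: integral_poly_pderiv)
qed

text \<open>Each integration by parts moves one derivative from \<open>Q\<close> to \<open>f\<close>; the boundary terms vanish,
  and after \<open>n\<close> steps the factor \<open>f\<close> has been differentiated away.\<close>

lemma integral_mult_higher_pderiv_eq_0:
  fixes f Q :: "real poly"
  assumes "\<forall>i<n. poly ((pderiv ^^ i) Q) 1 = 0 \<and> poly ((pderiv ^^ i) Q) (-1) = 0"
    and "(pderiv ^^ n) f = 0"
  shows "integral {-1..1} (poly (f * (pderiv ^^ n) Q)) = 0"
  using assms
proof (induction n arbitrary: f)
  case 0
  then have "poly (f * (pderiv ^^ 0) Q) = (\<lambda>t. 0)"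
    by auto
  then show ?case
    by (simp only: integral_0)
next
  case (Suc n)
  have "(pderiv ^^ n) (pderiv f) = 0"
    using Suc.prems(2) by (simp add: funpow_Suc_right del: funpow.simps)
  then have "integral {-1..1} (poly (pderiv f * (pderiv ^^ n) Q)) = 0"
    using Suc.prems(1) by (intro Suc.IH) simp_all
  then show ?case
    using Suc.prems(1) by (simp add: integral_by_parts_poly del: poly_mult)
qed

lemma integral_poly_mult_eq_0:
  fixes p f :: "real poly"
  assumes "\<forall>i\<le>n. integral {-1..1} (\<lambda>t. t ^ i * poly p t) = 0" and "degree f \<le> n"
  shows "integral {-1..1} (poly (f * p)) = 0"
proof -
  have "integral {-1..1} (poly (f * p))
      = integral {-1..1} (\<lambda>t. \<Sum>i\<le>degree f. coeff f i * (t ^ i * poly p t))"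
    by (intro integral_cong) (simp add: poly_altdef [of f] sum_distrib_right mult.assoc power_commuting_commutes)
  also have "\<dots> = (\<Sum>i\<le>degree f. integral {-1..1} (\<lambda>t. coeff f i * (t ^ i * poly p t)))"
    by (intro integral_sum) (auto intro!: integrable_continuous_real continuous_intros)
  also have "\<dots> = 0"
    using assms by simp
  finally show ?thesis .
qed

lemma poly_eq_0_if_integral_eq_0:
  fixes p :: "real poly"
  assumes "integral {-1..1} (poly p) = 0" and "\<And>t. t \<in> {-1..1} \<Longrightarrow> poly p t \<ge> 0"
  shows "p = 0"
proof (rule ccontr)
  assume "p \<noteq> 0"
  then have "finite {t. poly p t = 0}"
    by (rule poly_roots_finite)
  moreover have "continuous_on {-1..1} (poly p)"
    by (intro continuous_intros)
  then have "\<forall>t\<in>{-1..1}. poly p t = 0"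
    using assms by (subst integral_eq_0_iff [symmetric]) auto
  then have "{-1..1} \<subseteq> {t. poly p t = 0}"
    by auto
  ultimately have "finite {-1..1::real}"
    by (rule finite_subset [rotated])
  then show False
    using infinite_Icc [of "-1" "1 :: real"] by simp
qed


section \<open>The kernel polynomial\<close>

lemma power_dvd_pderiv:
  fixes p :: "real poly"
  assumes "[:-c, 1:] ^ Suc n dvd p"
  shows "[:-c, 1:] ^ n dvd pderiv p"
proof -
  from assms obtain s where "p = [:-c, 1:] ^ Suc n * s" ..
  then have "pderiv p = [:-c, 1:] ^ n * ([:-c, 1:] * pderiv s + smult (real (Suc n)) s)"
    by (simp add: pderiv_mult pderiv_power_Suc pderiv_pCons algebra_simps del: power_Suc)
      (simp add: algebra_simps)
  then show ?thesis
    by simp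
qed

lemma power_dvd_higher_pderiv:
  fixes p :: "real poly"
  assumes "[:-c, 1:] ^ (n + i) dvd p"
  shows "[:-c, 1:] ^ n dvd (pderiv ^^ i) p"
  using assms
proof (induction i arbitrary: n)
  case (Suc i)
  then have "[:-c, 1:] ^ Suc n dvd (pderiv ^^ i) p"
    by (metis add_Suc_shift)
  then show ?case
    using power_dvd_pderiv by simp
qed simp

lemma power_dvd_iff_higher_pderiv:
  fixes p :: "real poly"
  shows "[:-c, 1:] ^ Suc k dvd p \<longleftrightarrow> (\<forall>i\<le>k. poly ((pderiv ^^ i) p) c = 0)"
proof
  assume dvd: "[:-c, 1:] ^ Suc k dvd p"
  show "\<forall>i\<le>k. poly ((pderiv ^^ i) p) c = 0"
  proof (intro allI impI)
    fix i assume "i \<le> k"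
    then have "[:-c, 1:] ^ (1 + i) dvd p"
      by (intro dvd_trans [OF le_imp_power_dvd dvd]) simp
    from power_dvd_higher_pderiv [OF this] show "poly ((pderiv ^^ i) p) c = 0"
      by (simp add: poly_eq_0_iff_dvd)
  qed
next
  assume "\<forall>i\<le>k. poly ((pderiv ^^ i) p) c = 0"
  then show "[:-c, 1:] ^ Suc k dvd p"
  proof (induction k arbitrary: p)
    case 0
    then show ?case
      by (simp add: poly_eq_0_iff_dvd)
  next
    case (Suc k)
    have "poly ((pderiv ^^ i) (pderiv p)) c = 0" if "i \<le> k" for i
      using Suc.prems that by (metis Suc_le_mono comp_apply funpow_Suc_right)
    then have dvd: "[:-c, 1:] ^ Suc k dvd pderiv p"
      by (intro Suc.IH) blast
    have root: "poly p c = 0"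
      using Suc.prems by force
    show ?case
    proof (cases "pderiv p = 0")
      case True
      then obtain e where "p = [:e:]"
        using pderiv_iszero by blast
      with root have "p = 0"
        by simp
      then show ?thesis
        by simp
    next
      case False
      then have "p \<noteq> 0"
        by auto
      then have "order c p = Suc (order c (pderiv p))"
        using root by (rule order_pderiv)
      with dvd False show ?thesis
        by (simp add: order_divides del: power_Suc)
    qed
  qed
qed

lemma one_minus_square_power_dvd:
  fixes p :: "real poly"
  assumes "[:-1, 1:] ^ n dvd p" and "[:1, 1:] ^ n dvd p"
  shows "[:1, 0, -1:] ^ n dvd p"
proof -
  from assms(1) obtain s where s: "p = [:-1, 1:] ^ n * s" ..
  have "[:1, 1:] ^ n dvd s"
  proof (cases "s = 0")
    case False
    have "order (-1) ([:-1, 1 :: real:] ^ n) = 0"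
      by (intro order_0I) simp
    then have "order (-1) p = order (-1) s"
      unfolding s using False by (subst order_mult) auto
    then show ?thesis
      using assms(2) order_divides [of "-1" n p] order_divides [of "-1" n s] s by auto
  qed simp
  then have "[:-1, 1:] ^ n * [:1, 1:] ^ n dvd p"
    unfolding s by (rule mult_dvd_mono [OF dvd_refl])
  then have "(- [:1, 0, -1:]) ^ n dvd p"
    by (simp add: power_mult_distrib [symmetric] del: power_mult_distrib)
  then show ?thesis
    by (subst (asm) power_minus) (auto simp: dvd_def)
qed

text \<open>A polynomial \<open>p\<close> with contact of order \<open>k\<close> at the end points is \<open>(1 - t\<^sup>2) ^ (k + 1) * r\<close>.
  If its degree is bounded as below, then \<open>degree r \<le> m\<close>, so the vanishing
  moments up to order \<open>m\<close> give \<open>\<integral> p * r = 0\<close>. The integrand \<open>(1 - t\<^sup>2) ^ (k + 1) * r\<^sup>2\<close> is nonnegative, so \<open>r = 0\<close>.\<close>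

lemma eq_0_if_moments_eq_0:
  fixes p :: "real poly"
  assumes deg: "degree p \<le> 2 * (m div 2 + k + 1)"
    and contact: "\<forall>i\<le>k. poly ((pderiv ^^ i) p) 1 = 0 \<and> poly ((pderiv ^^ i) p) (-1) = 0"
    and moments: "\<forall>i\<le>m. integral {-1..1} (\<lambda>t. t ^ i * poly p t) = 0"
  shows "p = 0"
proof -
  let ?w = "[:1, 0, -1 :: real:] ^ Suc k"
  have "[:-1, 1:] ^ Suc k dvd p" "[:1, 1:] ^ Suc k dvd p"
    using contact power_dvd_iff_higher_pderiv [of 1 k p] power_dvd_iff_higher_pderiv [of "-1" k p]
    by auto
  then have "?w dvd p"
    by (rule one_minus_square_power_dvd)
  then obtain r where r: "p = ?w * r" ..
  have "degree r \<le> m"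
  proof (cases "r = 0")
    case False
    have "degree p = 2 * Suc k + degree r"
      unfolding r using False by (subst degree_mult_eq) (auto simp: degree_power_eq simp del: power_Suc)
    then show ?thesis
      using deg by auto
  qed simp
  then have "integral {-1..1} (poly (r * p)) = 0"
    by (rule integral_poly_mult_eq_0 [OF moments])
  moreover have "poly (r * p) t \<ge> 0" if "t \<in> {-1..1}" for t
  proof -
    have "t ^ 2 \<le> 1"
      using that by (simp add: abs_square_le_1 abs_le_iff)
    then have "0 \<le> poly ?w t * (poly r t) ^ 2"
      by (auto simp: power2_eq_square poly_power simp del: power_Suc)
    also have "\<dots> = poly (r * p) t"
      by (simp add: r power2_eq_square)
    finally show ?thesis .
  qed
  ultimately have "r * p = 0"
    by (rule poly_eq_0_if_integral_eq_0)
  then show ?thesis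
    using r by auto
qed

lemma pcompose_minus_higher_pderiv:
  fixes p :: "real poly"
  assumes "pcompose p [:0, -1:] = p"
  shows "pcompose ((pderiv ^^ n) p) [:0, -1:] = (-1) ^ n * (pderiv ^^ n) p"
proof (induction n)
  case (Suc n)
  have "pderiv ((-1) ^ n * (pderiv ^^ n) p) = (-1) ^ n * pderiv ((pderiv ^^ n) p)"
    by (cases "even n") (auto simp: pderiv_minus)
  then have "pderiv (pcompose ((pderiv ^^ n) p) [:0, -1:]) = (-1) ^ n * pderiv ((pderiv ^^ n) p)"
    by (simp only: Suc.IH)
  then have "- pcompose (pderiv ((pderiv ^^ n) p)) [:0, -1:] = (-1) ^ n * pderiv ((pderiv ^^ n) p)"
    by (simp add: pderiv_pcompose pderiv_pCons)
  then show ?case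
    by (simp add: minus_equation_iff)
qed (simp add: assms)

lemma degree_higher_pderiv: "degree ((pderiv ^^ n) p) = degree (p :: real poly) - n"
  by (induction n) (simp_all add: degree_pderiv)

definition kernel_poly :: "nat \<Rightarrow> nat \<Rightarrow> real poly \<Rightarrow> bool" where
  "kernel_poly m k p \<longleftrightarrow>
     degree p = 2 * (m div 2 + k + 1) \<and>
     integral {-1..1} (poly p) = 1 \<and>
     (\<forall>i\<le>k. poly ((pderiv ^^ i) p) 1 = 0 \<and> poly ((pderiv ^^ i) p) (-1) = 0) \<and>
     (\<forall>i\<in>{1..m}. integral {-1..1} (\<lambda>t. t ^ i * poly p t) = 0)"

text \<open>Write \<open>M\<close> for \<open>m div 2\<close>. The moment conditions say that \<open>t * p\<close> is orthogonal to all
  polynomials of degree at most \<open>2 * M\<close>, so it should be a derivative of order \<open>2 * M + 1\<close> of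
  a polynomial with high contact at the end points. Counting degrees leaves, up to a factor, only
  \<open>(t\<^sup>2 - 1) ^ (2 * M + k + 2)\<close>: a Rodrigues formula. This power is even, so its derivative of
  odd order is odd and can be divided by \<open>t\<close>.\<close>

lemma ex_kernel_poly: "\<exists>p. kernel_poly m k p"
proof -
  define M where "M = m div 2"
  have m: "m \<le> 2 * M + 1"
    by (simp add: M_def)
  define K where "K = 2 * M + k + 2"
  define Q where "Q = [:-1, 0, 1 :: real:] ^ K"
  define V where "V = (pderiv ^^ (2 * M + 1)) Q"
  have Q: "Q = [:-1, 1:] ^ K * [:1, 1:] ^ K"
    by (simp add: Q_def power_mult_distrib [symmetric] del: power_mult_distrib)
  have "degree Q = 2 * K"
    by (simp add: Q_def degree_power_eq)
  then have degV: "degree V = 2 * M + 2 * k + 3"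
    unfolding V_def degree_higher_pderiv by (simp add: K_def)
  have "pcompose Q [:0, -1:] = Q"
    by (intro iffD1 [OF poly_eq_poly_eq_iff] ext) (simp add: Q_def poly_pcompose)
  then have "pcompose V [:0, -1:] = - V"
    unfolding V_def by (subst pcompose_minus_higher_pderiv) auto
  then have "poly V 0 = - poly V 0"
    by (metis mult_zero_left poly_minus poly_pCons poly_pcompose add.right_neutral)
  then have "[:0, 1:] dvd V"
    using poly_eq_0_iff_dvd [of V 0] by simp
  then obtain p where p: "V = [:0, 1:] * p" ..
  have "V \<noteq> 0"
    using degV by auto
  then have "p \<noteq> 0"
    using p by auto
  then have degp: "degree p = 2 * (M + k + 1)"
    using degV unfolding p by (subst (asm) degree_mult_eq) auto
  have contact: "\<forall>i\<le>k. poly ((pderiv ^^ i) p) c = 0" if "c = 1 \<or> c = -1" for c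
  proof -
    have "[:-c, 1:] ^ K dvd Q"
      using that by (auto simp: Q)
    moreover have "K = Suc k + (2 * M + 1)"
      by (simp add: K_def)
    ultimately have "[:-c, 1:] ^ (Suc k + (2 * M + 1)) dvd Q"
      by metis
    then have "[:-c, 1:] ^ Suc k dvd [:0, 1:] * p"
      unfolding p [symmetric] V_def by (rule power_dvd_higher_pderiv)
    moreover have "order c [:0, 1:] = 0"
      using that by (intro order_0I) auto
    then have "order c ([:0, 1:] * p) = order c p"
      using \<open>p \<noteq> 0\<close> by (subst order_mult) auto
    ultimately have "[:-c, 1:] ^ Suc k dvd p"
      using \<open>p \<noteq> 0\<close> unfolding order_divides by auto
    then show ?thesis
      by (simp add: power_dvd_iff_higher_pderiv del: power_Suc)
  qed
  have moment: "integral {-1..1} (\<lambda>t. t ^ i * poly p t) = 0" if "i \<in> {1..m}" for i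
  proof -
    have "integral {-1..1} (\<lambda>t. t ^ i * poly p t) = integral {-1..1} (poly (monom 1 (i - 1) * V))"
      using that by (intro integral_cong) (auto simp: p poly_monom power_eq_if)
    also have "\<dots> = 0"
      unfolding V_def
    proof (rule integral_mult_higher_pderiv_eq_0)
      have "poly ((pderiv ^^ j) Q) c = 0" if "j < 2 * M + 1" "c = 1 \<or> c = -1" for j c
      proof -
        have "[:-c, 1:] ^ Suc (K - 1) dvd Q"
          using that by (auto simp: Q K_def simp del: power_Suc)
        then show ?thesis
          using that by (subst (asm) power_dvd_iff_higher_pderiv) (auto simp: K_def)
      qed
      then show "\<forall>j<2 * M + 1. poly ((pderiv ^^ j) Q) 1 = 0 \<and> poly ((pderiv ^^ j) Q) (-1) = 0"
        by simp
      have "degree ((pderiv ^^ (2 * M)) (monom (1 :: real) (i - 1))) = 0"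
        using that m by (simp add: degree_higher_pderiv degree_monom_eq)
      then show "(pderiv ^^ (2 * M + 1)) (monom (1 :: real) (i - 1)) = 0"
        by (simp add: pderiv_eq_0_iff)
    qed
    finally show ?thesis .
  qed
  define c where "c = integral {-1..1} (poly p)"
  \<comment> \<open>If the mean vanished as well, then all moments up to \<open>m\<close> would, which forces \<open>p = 0\<close>.\<close>
  have "c \<noteq> 0"
  proof
    assume "c = 0"
    have "integral {-1..1} (\<lambda>t. t ^ i * poly p t) = 0" if "i \<le> m" for i
      using \<open>c = 0\<close> moment [of i] that by (cases "i = 0") (auto simp: c_def)
    then have "p = 0"
      using degp contact by (intro eq_0_if_moments_eq_0 [of p m k]) (auto simp: M_def)
    with \<open>p \<noteq> 0\<close> show False ..
  qed
  have pderiv_smult: "(pderiv ^^ i) (smult (1 / c) p) = smult (1 / c) ((pderiv ^^ i) p)" for i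
    by (induction i) (auto simp: Polynomial.pderiv_smult)
  have "kernel_poly m k (smult (1 / c) p)"
    unfolding kernel_poly_def
  proof (intro conjI ballI allI impI)
    show "degree (smult (1 / c) p) = 2 * (m div 2 + k + 1)"
      using degp \<open>c \<noteq> 0\<close> by (simp add: M_def)
    have "integral {-1..1} (\<lambda>t. (1 / c) * poly p t) = (1 / c) * c"
      unfolding c_def by (rule integral_mult_right)
    moreover have "poly (smult (1 / c) p) = (\<lambda>t. (1 / c) * poly p t)"
      by auto
    ultimately show "integral {-1..1} (poly (smult (1 / c) p)) = 1"
      using \<open>c \<noteq> 0\<close> by simp
    fix i assume "i \<in> {1..m}"
    then have "integral {-1..1} (\<lambda>t. (1 / c) * (t ^ i * poly p t)) = 0"
      by (subst integral_mult_right) (simp add: moment)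
    then show "integral {-1..1} (\<lambda>t. t ^ i * poly (smult (1 / c) p) t) = 0"
      by (simp add: mult_ac)
  qed (use contact in \<open>auto simp: pderiv_smult\<close>)
  then show ?thesis ..
qed

lemma kernel_poly_unique:
  assumes p: "kernel_poly m k p" and p': "kernel_poly m k p'"
  shows "p = p'"
proof -
  have pderiv_diff: "(pderiv ^^ i) (p - p') = (pderiv ^^ i) p - (pderiv ^^ i) p'" for i
    by (induction i) (auto simp: Polynomial.pderiv_diff)
  have moment_diff: "integral {-1..1} (\<lambda>t. t ^ i * poly (p - p') t) =
      integral {-1..1} (\<lambda>t. t ^ i * poly p t) - integral {-1..1} (\<lambda>t. t ^ i * poly p' t)" for i
    by (simp add: right_diff_distrib)
      (intro integral_diff integrable_continuous_real continuous_intros)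
  have "integral {-1..1} (\<lambda>t. t ^ i * poly (p - p') t) = 0" if "i \<le> m" for i
    unfolding moment_diff using p p' that by (cases "i = 0") (auto simp: kernel_poly_def)
  moreover have "degree (p - p') \<le> 2 * (m div 2 + k + 1)"
    using p p' by (intro degree_diff_le) (auto simp: kernel_poly_def)
  ultimately have "p - p' = 0"
    using p p' by (intro eq_0_if_moments_eq_0 [of _ m k]) (auto simp: kernel_poly_def pderiv_diff)
  then show ?thesis
    by simp
qed

lemma kernel_poly_delta_poly: "kernel_poly m k (delta_poly m k)"
proof -
  have "delta_poly m k = (THE p. kernel_poly m k p)"
    unfolding delta_poly_def kernel_poly_def ..
  moreover have "\<exists>!p. kernel_poly m k p"
    using ex_kernel_poly kernel_poly_unique by blast
  ultimately show ?thesis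
    by (metis theI')
qed


section \<open>Differentiability of the convolution integrand\<close>

lemma DERIV_nth_deriv_on:
  assumes "nth_deriv_on {a..b} j S differentiable (at t)" and "t \<in> {a<..<b}"
  shows "DERIV (nth_deriv_on {a..b} j S) t :> nth_deriv_on {a..b} (Suc j) S t"
proof -
  have "at t within {a..b} = at t"
    using assms(2) by (intro at_within_Icc_at) auto
  then have "nth_deriv_on {a..b} (Suc j) S t = vector_derivative (nth_deriv_on {a..b} j S) (at t)"
    by (simp add: nth_deriv_on_def)
  then show ?thesis
    using assms(1)
    by (simp add: has_real_derivative_iff_has_vector_derivative vector_derivative_works [symmetric])
qed

lemma continuously_differentiable_on_DERIV:
  assumes "continuously_differentiable_on m S {a..b}" and "j < m" and "t \<in> {a<..<b}"
  shows "DERIV (nth_deriv_on {a..b} j S) t :> nth_deriv_on {a..b} (Suc j) S t"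
proof (rule DERIV_nth_deriv_on)
  have "nth_deriv_on {a..b} j S differentiable (at t within {a..b})"
    using assms by (auto simp: continuously_differentiable_on_def differentiable_on_def)
  moreover have "at t within {a..b} = at t"
    using assms(3) by (intro at_within_Icc_at) auto
  ultimately show "nth_deriv_on {a..b} j S differentiable (at t)"
    by simp
qed fact

lemma continuously_differentiable_on_bound:
  assumes "continuously_differentiable_on m S {a..b}"
  obtains A where "\<And>j t. j \<le> m \<Longrightarrow> t \<in> {a..b} \<Longrightarrow> \<bar>nth_deriv_on {a..b} j S t\<bar> \<le> A"
proof -
  have "continuous_on {a..b} (nth_deriv_on {a..b} j S)" if "j \<le> m" for j
    using assms that by (cases "j = m")
      (auto simp: continuously_differentiable_on_def intro: differentiable_imp_continuous_on)
  then have "bounded (\<Union>j\<in>{..m}. nth_deriv_on {a..b} j S ` {a..b})"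
    by (intro bounded_UN) (auto intro!: compact_imp_bounded compact_continuous_image)
  then obtain A where A: "\<forall>y\<in>(\<Union>j\<in>{..m}. nth_deriv_on {a..b} j S ` {a..b}). norm y \<le> A"
    by (auto simp: bounded_iff)
  show ?thesis
    by (rule that [of A]) (use A in auto)
qed

lemma higher_pderiv_bound:
  fixes p :: "real poly"
  obtains K where "\<And>j u. j \<le> k \<Longrightarrow> u \<in> {c..d} \<Longrightarrow> \<bar>poly ((pderiv ^^ j) p) u\<bar> \<le> K"
proof -
  have "bounded (\<Union>j\<in>{..k}. poly ((pderiv ^^ j) p) ` {c..d})"
    by (intro bounded_UN)
      (auto intro!: compact_imp_bounded compact_continuous_image continuous_intros)
  then obtain K where K: "\<forall>y\<in>(\<Union>j\<in>{..k}. poly ((pderiv ^^ j) p) ` {c..d}). norm y \<le> K"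
    by (auto simp: bounded_iff)
  show ?thesis
    by (rule that [of K]) (use K in auto)
qed

definition delta_deriv :: "nat \<Rightarrow> nat \<Rightarrow> real \<Rightarrow> nat \<Rightarrow> real \<Rightarrow> real" where
  "delta_deriv m k \<epsilon> j u =
     (if u \<in> {-\<epsilon>..\<epsilon>} then poly ((pderiv ^^ j) (delta_poly m k)) (u / \<epsilon>) / \<epsilon> ^ Suc j else 0)"

lemma delta_deriv_0: "delta_deriv m k \<epsilon> 0 = delta m k \<epsilon>"
  by (auto simp: fun_eq_iff delta_deriv_def delta_def abs_le_iff)

text \<open>At the two end points of the support the one-sided derivatives agree, because the
  derivatives of \<open>delta_poly m k\<close> up to order \<open>k\<close> vanish at \<open>\<plusminus>1\<close>.\<close>

lemma DERIV_delta_deriv: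
  assumes "\<epsilon> > 0" and "j < k"
  shows "DERIV (delta_deriv m k \<epsilon> j) u :> delta_deriv m k \<epsilon> (Suc j) u"
proof -
  let ?S = "{-\<epsilon>..\<epsilon>}"
  define f where "f = (\<lambda>i u. poly ((pderiv ^^ i) (delta_poly m k)) (u / \<epsilon>) / \<epsilon> ^ Suc i)"
  have f: "(f j has_vector_derivative f (Suc j) v) (at v within T)" for v T
    unfolding f_def has_real_derivative_iff_has_vector_derivative [symmetric]
    using assms(1) by (auto intro!: derivative_eq_intros simp: field_simps)
  have zero: "f i v = 0" if "i \<le> k" "v \<in> closure ?S" "v \<in> closure (- ?S)" for i v
  proof -
    have "v \<in> frontier ?S"
      using that(2,3) by (simp add: frontier_closures)
    then have "v = \<epsilon> \<or> v = - \<epsilon>"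
      using assms(1) by (auto simp: frontier_def)
    then show ?thesis
      using kernel_poly_delta_poly [of m k] that(1) assms(1) by (auto simp: f_def kernel_poly_def)
  qed
  have "((\<lambda>v. if v \<in> ?S then f j v else 0) has_vector_derivative
      (if u \<in> ?S then f (Suc j) u else 0)) (at u within UNIV)"
    by (rule has_vector_derivative_If_within_closures [where T = "- ?S"])
      (use zero assms(2) in \<open>auto intro: f\<close>)
  moreover have "(\<lambda>v. if v \<in> ?S then f j v else 0) = delta_deriv m k \<epsilon> j"
    by (auto simp: fun_eq_iff delta_deriv_def f_def)
  moreover have "(if u \<in> ?S then f (Suc j) u else 0) = delta_deriv m k \<epsilon> (Suc j) u"
    by (auto simp: delta_deriv_def f_def)
  ultimately show ?thesis
    by (simp only: has_real_derivative_iff_has_vector_derivative)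
qed

lemma DERIV_Leibniz:
  fixes f g :: "nat \<Rightarrow> real \<Rightarrow> real"
  assumes "\<And>i. i \<le> n \<Longrightarrow> DERIV (f i) t :> f (Suc i) t"
    and "\<And>i. i \<le> n \<Longrightarrow> DERIV (g i) t :> g (Suc i) t"
  shows "DERIV (\<lambda>t. \<Sum>i\<le>n. real (n choose i) * (f i t * g (n - i) t)) t :>
    (\<Sum>i\<le>Suc n. real (Suc n choose i) * (f i t * g (Suc n - i) t))"
proof -
  define a where "a = (\<lambda>i. f i t * g (Suc n - i) t)"
  have "DERIV (\<lambda>t. \<Sum>i\<le>n. real (n choose i) * (f i t * g (n - i) t)) t :>
      (\<Sum>i\<le>n. real (n choose i) * (f i t * g (Suc (n - i)) t + f (Suc i) t * g (n - i) t))"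
    by (intro DERIV_sum DERIV_cmult DERIV_mult' assms) auto
  also have "(\<Sum>i\<le>n. real (n choose i) * (f i t * g (Suc (n - i)) t + f (Suc i) t * g (n - i) t))
      = (\<Sum>i\<le>n. real (n choose i) * a i) + (\<Sum>i\<le>n. real (n choose i) * a (Suc i))"
    by (simp add: a_def Suc_diff_le distrib_left sum.distrib)
  also have "(\<Sum>i\<le>n. real (n choose i) * a i) = (\<Sum>i\<le>Suc n. real (n choose i) * a i)"
    by simp
  also have "\<dots> = a 0 + (\<Sum>i\<le>n. real (n choose Suc i) * a (Suc i))"
    by (subst sum.atMost_Suc_shift) simp
  also have "\<dots> + (\<Sum>i\<le>n. real (n choose i) * a (Suc i))
      = a 0 + (\<Sum>i\<le>n. real (Suc n choose Suc i) * a (Suc i))"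
    by (simp add: distrib_right sum.distrib)
  also have "\<dots> = (\<Sum>i\<le>Suc n. real (Suc n choose i) * a i)"
    by (subst sum.atMost_Suc_shift) simp
  finally show ?thesis
    by (simp add: a_def)
qed

text \<open>The candidate for the derivative of order \<open>n\<close> of \<open>\<lambda>t. S t * delta m k \<epsilon> (x - t)\<close>,
  as given by the Leibniz rule.\<close>

definition integrand_deriv ::
  "nat \<Rightarrow> nat \<Rightarrow> real \<Rightarrow> real \<Rightarrow> (real \<Rightarrow> real) \<Rightarrow> real \<Rightarrow> real \<Rightarrow> nat \<Rightarrow> real \<Rightarrow> real" where
  "integrand_deriv m k a b S \<epsilon> x n t = (\<Sum>i\<le>n. real (n choose i) *
     (nth_deriv_on {a..b} i S t * ((-1) ^ (n - i) * delta_deriv m k \<epsilon> (n - i) (x - t))))"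

lemma integrand_deriv_0: "integrand_deriv m k a b S \<epsilon> x 0 t = S t * delta m k \<epsilon> (x - t)"
  by (simp add: integrand_deriv_def nth_deriv_on_def delta_deriv_0)

lemma integrand_deriv_outside:
  assumes "t \<notin> {x - \<epsilon>..x + \<epsilon>}"
  shows "integrand_deriv m k a b S \<epsilon> x n t = 0"
  using assms by (auto simp: integrand_deriv_def delta_deriv_def intro!: sum.neutral)

text \<open>The support of the kernel lies in the open interval \<open>{a<..<b}\<close>, where the derivatives of \<open>S\<close>
  are two-sided; off the support the integrand vanishes on an open set, which covers the end points
  \<open>a\<close> and \<open>b\<close>.\<close>

lemma DERIV_integrand_deriv:
  assumes S: "continuously_differentiable_on m S {a..b}"
    and "\<epsilon> > 0" and "a + \<epsilon> < x" and "x < b - \<epsilon>" and "n < m" and "n < k"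
  shows "DERIV (integrand_deriv m k a b S \<epsilon> x n) t :> integrand_deriv m k a b S \<epsilon> x (Suc n) t"
proof (cases "t \<in> {x - \<epsilon>..x + \<epsilon>}")
  case True
  have "DERIV (\<lambda>t. (-1) ^ j * delta_deriv m k \<epsilon> j (x - t)) t :>
      (-1) ^ Suc j * delta_deriv m k \<epsilon> (Suc j) (x - t)" if "j \<le> n" for j
  proof -
    have "DERIV (\<lambda>t. delta_deriv m k \<epsilon> j (x - t)) t :> delta_deriv m k \<epsilon> (Suc j) (x - t) * - 1"
      using assms that
      by (intro DERIV_chain2 [OF DERIV_delta_deriv]) (auto intro!: derivative_eq_intros)
    from DERIV_cmult [OF this, of "(-1) ^ j"] show ?thesis
      by simp
  qed
  then show ?thesis
    unfolding integrand_deriv_def [abs_def]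
    using True assms by (intro DERIV_Leibniz continuously_differentiable_on_DERIV [OF S]) auto
next
  case False
  have "open (- {x - \<epsilon>..x + \<epsilon>})"
    by (simp add: open_Compl)
  then have "DERIV (integrand_deriv m k a b S \<epsilon> x n) t :> 0"
    using False integrand_deriv_outside [of _ x \<epsilon>]
    by (intro has_field_derivative_transform_within_open [OF DERIV_const, of _ _ 0]) auto
  then show ?thesis
    using integrand_deriv_outside [OF False] by simp
qed

text \<open>Each derivative of the kernel costs a factor \<open>1 / \<epsilon>\<close>, and the kernel itself has size
  \<open>1 / \<epsilon>\<close>. The terms in which \<open>S\<close> is differentiated carry fewer such factors; as \<open>\<epsilon>\<close> is bounded
  by \<open>b - a\<close>, they are of the required order too.\<close>

lemma integrand_deriv_bound:
  assumes S: "continuously_differentiable_on m S {a..b}" and "n \<le> m" and "n \<le> k"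
  obtains C where "\<And>\<epsilon> x t. \<epsilon> > 0 \<Longrightarrow> a + \<epsilon> < x \<Longrightarrow> x < b - \<epsilon> \<Longrightarrow>
    \<bar>integrand_deriv m k a b S \<epsilon> x n t\<bar> \<le> C / \<epsilon> ^ Suc n"
proof -
  obtain A where A: "\<And>j t. j \<le> m \<Longrightarrow> t \<in> {a..b} \<Longrightarrow> \<bar>nth_deriv_on {a..b} j S t\<bar> \<le> A"
    using continuously_differentiable_on_bound [OF S] by blast
  obtain K where K: "\<And>j u. j \<le> k \<Longrightarrow> u \<in> {-1..1} \<Longrightarrow>
      \<bar>poly ((pderiv ^^ j) (delta_poly m k)) u\<bar> \<le> K"
    using higher_pderiv_bound [of k "-1" 1 "delta_poly m k"] by blast
  have "K \<ge> 0"
    using K [of 0 0] by simp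
  define L where "L = (1 + \<bar>b - a\<bar>) ^ n"
  show ?thesis
  proof (rule that)
    fix \<epsilon> x t :: real
    assume \<epsilon>: "\<epsilon> > 0" "a + \<epsilon> < x" "x < b - \<epsilon>"
    have "A \<ge> 0"
      using A [of 0 a] \<epsilon> by simp
    show "\<bar>integrand_deriv m k a b S \<epsilon> x n t\<bar> \<le> (2 ^ n * (A * K * L)) / \<epsilon> ^ Suc n"
    proof (cases "t \<in> {x - \<epsilon>..x + \<epsilon>}")
      case True
      have "\<bar>nth_deriv_on {a..b} i S t * ((-1) ^ (n - i) * delta_deriv m k \<epsilon> (n - i) (x - t))\<bar>
          \<le> A * K * L / \<epsilon> ^ Suc n" if "i \<le> n" for i
      proof -
        have "\<epsilon> ^ i \<le> (1 + \<bar>b - a\<bar>) ^ i"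
          using \<epsilon> by (intro power_mono) auto
        also have "\<dots> \<le> L"
          unfolding L_def using that by (intro power_increasing) auto
        finally have "\<epsilon> ^ i \<le> L" .
        have "\<epsilon> ^ Suc n = \<epsilon> ^ Suc (n - i) * \<epsilon> ^ i"
          using that by (simp add: power_add [symmetric])
        then have "1 / \<epsilon> ^ Suc (n - i) = \<epsilon> ^ i / \<epsilon> ^ Suc n"
          using \<epsilon>(1) by simp
        also have "\<dots> \<le> L / \<epsilon> ^ Suc n"
          using \<open>\<epsilon> ^ i \<le> L\<close> \<epsilon>(1) by (intro divide_right_mono) auto
        finally have L: "1 / \<epsilon> ^ Suc (n - i) \<le> L / \<epsilon> ^ Suc n" .
        have "x - t \<in> {-\<epsilon>..\<epsilon>}" "(x - t) / \<epsilon> \<in> {-1..1}"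
          using True \<epsilon>(1) by (auto simp: field_simps)
        then have "\<bar>delta_deriv m k \<epsilon> (n - i) (x - t)\<bar> \<le> K * (1 / \<epsilon> ^ Suc (n - i))"
          using K [of "n - i" "(x - t) / \<epsilon>"] \<epsilon>(1) assms(3)
          by (auto simp: delta_deriv_def abs_mult divide_right_mono)
        also have "\<dots> \<le> K * (L / \<epsilon> ^ Suc n)"
          using L \<open>K \<ge> 0\<close> by (rule mult_left_mono)
        finally have "\<bar>delta_deriv m k \<epsilon> (n - i) (x - t)\<bar> \<le> K * (L / \<epsilon> ^ Suc n)" .
        moreover have "\<bar>nth_deriv_on {a..b} i S t\<bar> \<le> A"
          using A [of i t] that assms(2) True \<epsilon> by auto
        ultimately have "\<bar>nth_deriv_on {a..b} i S t\<bar> * \<bar>delta_deriv m k \<epsilon> (n - i) (x - t)\<bar>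
            \<le> A * (K * (L / \<epsilon> ^ Suc n))"
          using \<open>A \<ge> 0\<close> by (intro mult_mono) auto
        then show ?thesis
          by (simp add: abs_mult power_abs mult.assoc)
      qed
      then have "\<bar>integrand_deriv m k a b S \<epsilon> x n t\<bar>
          \<le> (\<Sum>i\<le>n. real (n choose i) * (A * K * L / \<epsilon> ^ Suc n))"
        unfolding integrand_deriv_def
        by (intro order_trans [OF sum_abs] sum_mono, unfold abs_mult [of "real _"] abs_of_nat)
          (intro mult_left_mono, auto)
      also have "\<dots> = real (\<Sum>i\<le>n. n choose i) * (A * K * L / \<epsilon> ^ Suc n)"
        unfolding of_nat_sum sum_distrib_right ..
      also have "\<dots> = (2 ^ n * (A * K * L)) / \<epsilon> ^ Suc n"
        unfolding choose_row_sum by simp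
      finally show ?thesis .
    next
      case False
      then show ?thesis
        using integrand_deriv_outside [OF False] \<open>A \<ge> 0\<close> \<open>K \<ge> 0\<close> \<epsilon>(1) by (simp add: L_def)
    qed
  qed
qed


section \<open>The error of the regularisation\<close>

lemma convolution_delta_eq:
  assumes "\<epsilon> > 0" and "a + \<epsilon> < x" and "x < b - \<epsilon>"
    and S: "continuous_on {x - \<epsilon>..x + \<epsilon>} S"
  shows "integral {a..b} (\<lambda>t. S t * delta m k \<epsilon> (x - t)) =
    integral {-1..1} (\<lambda>u. S (x - \<epsilon> * u) * poly (delta_poly m k) u)"
proof -
  let ?f = "\<lambda>u. S (x - \<epsilon> * u) * poly (delta_poly m k) u"
  have bounds: "x - \<epsilon> * u \<in> {x - \<epsilon>..x + \<epsilon>}" if "u \<in> {-1..1}" for u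
    using that assms(1) mult_left_mono [of "-1" u \<epsilon>] mult_left_mono [of u 1 \<epsilon>] by auto
  \<comment> \<open>Substitute \<open>t = x - \<epsilon> * u\<close>.\<close>
  have "?f integrable_on {-1..1}"
    by (intro integrable_continuous_real continuous_intros continuous_on_compose2 [OF S])
      (use bounds in blast)
  then have "(?f has_integral integral {-1..1} ?f) (cbox (-1) 1)"
    by (simp add: integrable_integral)
  from has_integral_affinity [OF this, of "- 1 / \<epsilon>" "x / \<epsilon>"] assms(1)
  have "((\<lambda>t. ?f ((x - t) / \<epsilon>)) has_integral \<epsilon> * integral {-1..1} ?f)
      ((\<lambda>u. - \<epsilon> * u + x) ` {-1..1})"
    by (simp add: diff_divide_distrib)
  also have "(\<lambda>u. - \<epsilon> * u + x) ` {-1..1} = {x - \<epsilon>..x + \<epsilon>}"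
    using assms(1) by (subst image_affinity_atLeastAtMost) auto
  finally have "((\<lambda>t. ?f ((x - t) / \<epsilon>) / \<epsilon>) has_integral integral {-1..1} ?f) {x - \<epsilon>..x + \<epsilon>}"
    using assms(1) by (auto dest: has_integral_divide [of _ _ _ \<epsilon>])
  then have "((\<lambda>t. S t * delta m k \<epsilon> (x - t)) has_integral integral {-1..1} ?f) {x - \<epsilon>..x + \<epsilon>}"
    using assms(1) by (subst (asm) has_integral_cong) (auto simp: delta_def abs_le_iff)
  then have "((\<lambda>t. S t * delta m k \<epsilon> (x - t)) has_integral integral {-1..1} ?f) {a..b}"
    by (rule has_integral_on_superset) (use assms in \<open>auto simp: delta_def abs_le_iff\<close>)
  then show ?thesis
    by (rule integral_unique)
qed

text \<open>In the Taylor expansion of \<open>S (x - \<epsilon> * u)\<close> the moment conditions annihilate all terms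
  between the constant one and the remainder, and the remainder is of order \<open>\<epsilon> ^ (m + 1)\<close>.\<close>

lemma regularisation_error:
  assumes S: "continuously_differentiable_on m S {a..b}"
    and diff: "\<And>t. t \<in> {a<..<b} \<Longrightarrow> nth_deriv_on {a..b} m S differentiable (at t)"
    and bdd: "bounded (nth_deriv_on {a..b} (Suc m) S ` {a<..<b})"
  obtains C where "\<And>\<epsilon> x. \<epsilon> > 0 \<Longrightarrow> a + \<epsilon> < x \<Longrightarrow> x < b - \<epsilon> \<Longrightarrow>
    \<bar>S x - integral {a..b} (\<lambda>t. S t * delta m k \<epsilon> (x - t))\<bar> \<le> C * \<epsilon> ^ Suc m"
proof -
  let ?D = "\<lambda>j. nth_deriv_on {a..b} j S"
  obtain B where "\<forall>y\<in>?D (Suc m) ` {a<..<b}. norm y \<le> B"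
    using bdd unfolding bounded_iff by blast
  then have B: "\<bar>?D (Suc m) t\<bar> \<le> B" if "t \<in> {a<..<b}" for t
    using that by auto
  obtain K where K: "\<And>u. u \<in> {-1..1} \<Longrightarrow> \<bar>poly (delta_poly m k) u\<bar> \<le> K"
    using higher_pderiv_bound [of 0 "-1" 1 "delta_poly m k"] by (metis funpow_0 le_refl)
  have D0: "?D 0 = S"
    by (simp add: nth_deriv_on_def)
  have D: "DERIV (?D j) t :> ?D (Suc j) t" if "j < Suc m" "t \<in> {a<..<b}" for j t
    using that continuously_differentiable_on_DERIV [OF S] DERIV_nth_deriv_on [OF diff]
    by (cases "j = m") auto
  show ?thesis
  proof (rule that)
    fix \<epsilon> x :: real
    assume \<epsilon>: "\<epsilon> > 0" "a + \<epsilon> < x" "x < b - \<epsilon>"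
    define P where "P = poly (delta_poly m k)"
    define c where "c = (\<lambda>j. ?D j x / fact j * (- \<epsilon>) ^ j)"
    have "B \<ge> 0"
      using B [of x] \<epsilon> by auto
    have contP: "continuous_on A P" for A
      unfolding P_def by (intro continuous_intros)
    have contS: "continuous_on {x - \<epsilon>..x + \<epsilon>} S"
      using DERIV_isCont [OF D [of 0]] \<epsilon>
      by (intro continuous_at_imp_continuous_on) (simp add: D0)
    have bounds: "- \<epsilon> \<le> \<epsilon> * u" "\<epsilon> * u \<le> \<epsilon>" if "-1 \<le> u" "u \<le> 1" for u
      using that \<epsilon>(1) mult_left_mono [of "-1" u \<epsilon>] mult_left_mono [of u 1 \<epsilon>] by auto
    have "x - \<epsilon> * u \<in> {x - \<epsilon>..x + \<epsilon>}" if "u \<in> {-1..1}" for u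
      using bounds [of u] that by auto
    then have contS': "continuous_on {-1..1} (\<lambda>u. S (x - \<epsilon> * u))"
      by (intro continuous_intros continuous_on_compose2 [OF contS])
        blast
    have remainder: "\<bar>S (x - \<epsilon> * u) - (\<Sum>j\<le>m. c j * u ^ j)\<bar> \<le> B * \<epsilon> ^ Suc m"
      if u: "u \<in> {-1..1}" for u
    proof (cases "u = 0")
      case True
      have "(\<Sum>j\<le>m. c j * 0 ^ j) = c 0"
        by (subst sum.atMost_shift) simp
      then show ?thesis
        using True \<open>B \<ge> 0\<close> \<epsilon>(1) by (simp add: c_def D0)
    next
      case False
      have "\<exists>t. (if x - \<epsilon> * u < x then x - \<epsilon> * u < t \<and> t < x else x < t \<and> t < x - \<epsilon> * u) \<and>
          S (x - \<epsilon> * u) = (\<Sum>j<Suc m. (?D j x / fact j) * (x - \<epsilon> * u - x) ^ j) +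
            (?D (Suc m) t / fact (Suc m)) * (x - \<epsilon> * u - x) ^ Suc m"
        by (rule Taylor [where a = "x - \<epsilon>" and b = "x + \<epsilon>"])
          (use False \<epsilon> D D0 bounds [of u] u in auto)
      then obtain t where t: "if x - \<epsilon> * u < x then x - \<epsilon> * u < t \<and> t < x
            else x < t \<and> t < x - \<epsilon> * u"
          and Taylor: "S (x - \<epsilon> * u) = (\<Sum>j<Suc m. (?D j x / fact j) * (x - \<epsilon> * u - x) ^ j) +
            (?D (Suc m) t / fact (Suc m)) * (x - \<epsilon> * u - x) ^ Suc m"
        by blast
      have "(\<Sum>j<Suc m. (?D j x / fact j) * (x - \<epsilon> * u - x) ^ j) = (\<Sum>j\<le>m. c j * u ^ j)"
        unfolding lessThan_Suc_atMost
        by (intro sum.cong) (auto simp: c_def power_mult_distrib [symmetric])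
      then have "\<bar>S (x - \<epsilon> * u) - (\<Sum>j\<le>m. c j * u ^ j)\<bar>
          = \<bar>?D (Suc m) t\<bar> / fact (Suc m) * \<bar>\<epsilon> * u\<bar> ^ Suc m"
        unfolding Taylor by (simp add: abs_mult power_abs del: power_Suc fact_Suc)
      also have "\<dots> \<le> B * \<epsilon> ^ Suc m"
      proof (intro mult_mono power_mono)
        have "- \<epsilon> \<le> \<epsilon> * u \<and> \<epsilon> * u \<le> \<epsilon>"
          using bounds [of u] u by auto
        then have "a < t \<and> t < b"
          using t \<epsilon> by (smt (verit))
        then have "t \<in> {a<..<b}"
          by simp
        then have "\<bar>?D (Suc m) t\<bar> / fact (Suc m) \<le> \<bar>?D (Suc m) t\<bar> / 1"
          by (intro divide_left_mono) (auto simp del: fact_Suc)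
        also have "\<dots> \<le> B"
          using B \<open>t \<in> {a<..<b}\<close> by simp
        finally show "\<bar>?D (Suc m) t\<bar> / fact (Suc m) \<le> B" .
        show "\<bar>\<epsilon> * u\<bar> \<le> \<epsilon>"
          using bounds [of u] u by (auto simp: abs_le_iff)
      qed (use \<open>B \<ge> 0\<close> in auto)
      finally show ?thesis .
    qed
    have moment: "integral {-1..1} (\<lambda>u. u ^ j * P u) = (if j = 0 then 1 else 0)" if "j \<le> m" for j
      using kernel_poly_delta_poly [of m k] that by (auto simp: kernel_poly_def P_def)
    have "integral {-1..1} (\<lambda>u. (\<Sum>j\<le>m. c j * u ^ j) * P u)
        = (\<Sum>j\<le>m. integral {-1..1} (\<lambda>u. c j * (u ^ j * P u)))"
      unfolding sum_distrib_right mult.assoc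
      by (intro integral_sum integrable_continuous_real continuous_intros contP) auto
    also have "\<dots> = (\<Sum>j\<le>m. if j = 0 then c 0 else 0)"
      by (intro sum.cong) (auto simp: moment)
    also have "\<dots> = S x"
      by (simp add: c_def D0)
    finally have main: "integral {-1..1} (\<lambda>u. (\<Sum>j\<le>m. c j * u ^ j) * P u) = S x" .
    have "S x - integral {a..b} (\<lambda>t. S t * delta m k \<epsilon> (x - t)) =
        integral {-1..1} (\<lambda>u. (\<Sum>j\<le>m. c j * u ^ j) * P u - S (x - \<epsilon> * u) * P u)"
      unfolding convolution_delta_eq [OF \<epsilon> contS] main [symmetric] P_def [symmetric]
      by (intro integral_diff [symmetric] integrable_continuous_real
          continuous_intros contP contS')
    also have "\<bar>\<dots>\<bar> \<le> (B * \<epsilon> ^ Suc m * K) * (1 - (-1))"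
      unfolding real_norm_def [symmetric]
    proof (rule integral_bound)
      show "continuous_on {-1..1} (\<lambda>u. (\<Sum>j\<le>m. c j * u ^ j) * P u - S (x - \<epsilon> * u) * P u)"
        by (intro continuous_intros contP contS')
      fix u :: real
      assume u: "u \<in> {-1..1}"
      have "norm ((\<Sum>j\<le>m. c j * u ^ j) * P u - S (x - \<epsilon> * u) * P u)
          = \<bar>S (x - \<epsilon> * u) - (\<Sum>j\<le>m. c j * u ^ j)\<bar> * \<bar>P u\<bar>"
        by (simp add: abs_mult [symmetric] left_diff_distrib abs_minus_commute)
      also have "\<dots> \<le> B * \<epsilon> ^ Suc m * K"
        using remainder [OF u] K [OF u] \<epsilon>(1) \<open>B \<ge> 0\<close> by (intro mult_mono) (auto simp: P_def)
      finally show "norm ((\<Sum>j\<le>m. c j * u ^ j) * P u - S (x - \<epsilon> * u) * P u)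
          \<le> B * \<epsilon> ^ Suc m * K" .
    qed simp
    finally show "\<bar>S x - integral {a..b} (\<lambda>t. S t * delta m k \<epsilon> (x - t))\<bar> \<le> (2 * B * K) * \<epsilon> ^ Suc m"
      by (simp add: mult_ac)
  qed
qed


section \<open>The Newton--Cotes error\<close>

lemma nc_node_inj:
  assumes "\<xi> i < \<xi> (Suc i)" and "q \<ge> 1"
  shows "inj_on (nc_node q \<xi> i) J"
  using assms by (auto simp: inj_on_def nc_node_def nc_step_def)

lemma nc_node_in_interval:
  assumes "\<xi> i < \<xi> (Suc i)" and "q \<ge> 1" and "j \<le> q"
  shows "nc_node q \<xi> i j \<in> {\<xi> i..\<xi> (Suc i)}"
proof -
  have h: "nc_step q \<xi> i \<ge> 0"
    using assms by (simp add: nc_step_def)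
  then have "real j * nc_step q \<xi> i \<le> real q * nc_step q \<xi> i"
    using assms(3) by (intro mult_right_mono) auto
  also have "\<dots> = \<xi> (Suc i) - \<xi> i"
    using assms(2) by (simp add: nc_step_def)
  finally show ?thesis
    using h by (auto simp: nc_node_def)
qed

lemma nc_step_le_node_diff:
  assumes "\<xi> i < \<xi> (Suc i)" and "j \<noteq> l"
  shows "nc_step q \<xi> i \<le> \<bar>nc_node q \<xi> i j - nc_node q \<xi> i l\<bar>"
proof -
  have "\<bar>real j - real l\<bar> \<ge> 1"
    using assms(2) by auto
  moreover have "nc_step q \<xi> i \<ge> 0"
    using assms by (simp add: nc_step_def)
  ultimately have "1 * nc_step q \<xi> i \<le> \<bar>real j - real l\<bar> * nc_step q \<xi> i"
    by (intro mult_right_mono)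
  also have "\<dots> = \<bar>nc_node q \<xi> i j - nc_node q \<xi> i l\<bar>"
    using \<open>nc_step q \<xi> i \<ge> 0\<close>
    by (simp add: nc_node_def abs_mult [symmetric] left_diff_distrib [symmetric] abs_mult_pos)
  finally show ?thesis
    by simp
qed

lemma lagrange_interpolation:
  fixes p :: "real poly"
  assumes inj: "inj_on y {0..q}" and deg: "degree p \<le> q"
  shows "poly p t = (\<Sum>j=0..q. poly p (y j) * (\<Prod>l\<in>{0..q} - {j}. (t - y l) / (y j - y l)))"
proof -
  define L where "L = (\<lambda>j. \<Prod>l\<in>{0..q} - {j}. smult (1 / (y j - y l)) [:- y l, 1:])"
  define r where "r = (\<Sum>j=0..q. smult (poly p (y j)) (L j))"
  have polyL: "poly (L j) t = (\<Prod>l\<in>{0..q} - {j}. (t - y l) / (y j - y l))" for j t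
    unfolding L_def poly_prod by (intro prod.cong) (auto simp: diff_divide_distrib)
  have "degree (L j) \<le> q" if "j \<in> {0..q}" for j
  proof -
    have "degree (L j) \<le> sum (degree \<circ> (\<lambda>l. smult (1 / (y j - y l)) [:- y l, 1:])) ({0..q} - {j})"
      unfolding L_def by (rule degree_prod_sum_le) simp
    also have "\<dots> \<le> (\<Sum>l\<in>{0..q} - {j}. 1)"
      by (intro sum_mono) auto
    also have "\<dots> = q"
      using that by simp
    finally show ?thesis .
  qed
  then have "degree r \<le> q"
    unfolding r_def by (intro degree_sum_le) (auto intro: order_trans [OF degree_smult_le])
  have at_node: "poly (L j) (y i) = (if j = i then 1 else 0)"
    if "i \<in> {0..q}" "j \<in> {0..q}" for i j
  proof (cases "j = i")
    case True
    then have "y j \<noteq> y l" if "l \<in> {0..q} - {j}" for l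
      using inj \<open>i \<in> {0..q}\<close> that by (auto simp: inj_on_def)
    then show ?thesis
      unfolding polyL using True by (auto intro!: prod.neutral)
  next
    case False
    then show ?thesis
      unfolding polyL using that by (auto intro!: prod_zero)
  qed
  have "p = r"
  proof (rule poly_eqI_degree [where A = "y ` {0..q}"])
    show "card (y ` {0..q}) > degree p" "card (y ` {0..q}) > degree r"
      using deg \<open>degree r \<le> q\<close> by (simp_all add: card_image [OF inj])
    fix v assume "v \<in> y ` {0..q}"
    then obtain i where i: "i \<in> {0..q}" "v = y i"
      by auto
    have "poly r v = (\<Sum>j=0..q. if j = i then poly p (y i) else 0)"
      unfolding r_def poly_sum i(2) by (intro sum.cong) (auto simp: at_node [OF i(1)])
    then show "poly p v = poly r v"
      using i by simp
  qed
  then have "poly p t = poly r t"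
    by simp
  then show ?thesis
    by (simp add: r_def poly_sum polyL)
qed

lemma lagrange_basis_integrable:
  "(\<lambda>t. \<Prod>l\<in>{0..q} - {j}. (t - nc_node q \<xi> i l) / (nc_node q \<xi> i j - nc_node q \<xi> i l))
    integrable_on {c..d}"
  unfolding divide_inverse by (intro integrable_continuous_real continuous_intros)

lemma nc_exact:
  fixes p :: "real poly"
  assumes "\<xi> i < \<xi> (Suc i)" and "q \<ge> 1" and "degree p \<le> q"
  shows "integral {\<xi> i..\<xi> (Suc i)} (poly p) =
    (\<Sum>j=0..q. nc_weight q \<xi> i j * poly p (nc_node q \<xi> i j))"
proof -
  have "integral {\<xi> i..\<xi> (Suc i)} (poly p) =
      integral {\<xi> i..\<xi> (Suc i)} (\<lambda>t. \<Sum>j=0..q. poly p (nc_node q \<xi> i j) *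
        (\<Prod>l\<in>{0..q} - {j}. (t - nc_node q \<xi> i l) / (nc_node q \<xi> i j - nc_node q \<xi> i l)))"
    by (intro integral_cong lagrange_interpolation nc_node_inj assms)
  also have "\<dots> = (\<Sum>j=0..q. poly p (nc_node q \<xi> i j) * nc_weight q \<xi> i j)"
    unfolding nc_weight_def
    by (subst integral_sum)
      (auto intro!: integrable_on_mult_right lagrange_basis_integrable simp del: mult_eq_0_iff)
  finally show ?thesis
    by (simp add: mult.commute)
qed

text \<open>Each factor of the Lagrange basis polynomial is at most \<open>q\<close> in absolute value: the numerator
  is at most the length of the subinterval, the denominator at least one step.\<close>

lemma nc_weight_bound:
  assumes "\<xi> i < \<xi> (Suc i)" and "q \<ge> 1" and "j \<le> q"
  shows "\<bar>nc_weight q \<xi> i j\<bar> \<le> real q ^ q * (\<xi> (Suc i) - \<xi> i)"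
proof -
  let ?y = "nc_node q \<xi> i"
  have h: "nc_step q \<xi> i > 0" "\<xi> (Suc i) - \<xi> i = real q * nc_step q \<xi> i"
    using assms by (auto simp: nc_step_def)
  have "norm (nc_weight q \<xi> i j) \<le> (real q ^ q) * (\<xi> (Suc i) - \<xi> i)"
    unfolding nc_weight_def
  proof (rule integral_bound)
    show "continuous_on {\<xi> i..\<xi> (Suc i)} (\<lambda>t. \<Prod>l\<in>{0..q} - {j}. (t - ?y l) / (?y j - ?y l))"
      unfolding divide_inverse by (intro continuous_intros)
    fix t assume t: "t \<in> {\<xi> i..\<xi> (Suc i)}"
    have "\<bar>(t - ?y l) / (?y j - ?y l)\<bar> \<le> real q" if "l \<in> {0..q} - {j}" for l
    proof -
      have "\<bar>t - ?y l\<bar> \<le> real q * nc_step q \<xi> i"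
        using t nc_node_in_interval [OF assms(1,2), of l] that h(2) by auto
      also have "\<dots> \<le> real q * \<bar>?y j - ?y l\<bar>"
        using nc_step_le_node_diff [OF assms(1), of j l q] that by (intro mult_left_mono) auto
      finally show ?thesis
        using nc_step_le_node_diff [OF assms(1), of j l q] that h(1)
        by (subst abs_divide, subst pos_divide_le_eq) auto
    qed
    then have "(\<Prod>l\<in>{0..q} - {j}. \<bar>(t - ?y l) / (?y j - ?y l)\<bar>) \<le> (\<Prod>l\<in>{0..q} - {j}. real q)"
      by (intro prod_mono) auto
    also have "\<dots> = real q ^ q"
      using assms(3) by simp
    finally show "norm (\<Prod>l\<in>{0..q} - {j}. (t - ?y l) / (?y j - ?y l)) \<le> real q ^ q"
      by (simp only: real_norm_def abs_prod)
  qed (use assms in auto)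
  then show ?thesis
    by simp
qed

text \<open>Expand \<open>g 0\<close> at the left end point to order \<open>q\<close>. The rule is exact on the Taylor
  polynomial, so only the remainder contributes: it has size \<open>B * d ^ (q + 1)\<close> on a subinterval
  of length \<open>d\<close>, and both the integral and the weights contribute one more factor \<open>d\<close>.\<close>

lemma nc_error:
  fixes g :: "nat \<Rightarrow> real \<Rightarrow> real"
  assumes \<xi>: "\<xi> i < \<xi> (Suc i)" and q: "q \<ge> 1"
    and g: "\<And>n t. n \<le> q \<Longrightarrow> t \<in> {\<xi> i..\<xi> (Suc i)} \<Longrightarrow> DERIV (g n) t :> g (Suc n) t"
    and B: "\<And>t. t \<in> {\<xi> i..\<xi> (Suc i)} \<Longrightarrow> \<bar>g (Suc q) t\<bar> \<le> B"
  shows "\<bar>integral {\<xi> i..\<xi> (Suc i)} (g 0) -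
      (\<Sum>j=0..q. nc_weight q \<xi> i j * g 0 (nc_node q \<xi> i j))\<bar>
    \<le> (1 + real (Suc q) * real q ^ q) * real q ^ (q + 2) * B * nc_step q \<xi> i ^ (q + 2)"
proof -
  define c where "c = \<xi> i"
  define d where "d = \<xi> (Suc i) - \<xi> i"
  have d: "d > 0" "\<xi> (Suc i) = c + d" "d = real q * nc_step q \<xi> i"
    using \<xi> q by (auto simp: d_def c_def nc_step_def)
  have "B \<ge> 0"
    using B [of c] \<xi> by (auto simp: c_def)
  define T where "T = (\<Sum>n\<le>q. smult (g n c / fact n) ([:- c, 1:] ^ n))"
  have "degree T \<le> q"
    unfolding T_def
    by (intro degree_sum_le) (auto intro: order_trans [OF degree_smult_le] simp: degree_linear_power)
  have polyT: "poly T t = (\<Sum>n\<le>q. (g n c / fact n) * (t - c) ^ n)" for t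
    by (simp add: T_def poly_sum poly_power)
  define R where "R = (\<lambda>t. g 0 t - poly T t)"
  have R: "\<bar>R t\<bar> \<le> B * d ^ Suc q" if t: "t \<in> {c..c + d}" for t
  proof (cases "t = c")
    case True
    have "poly T c = g 0 c"
      unfolding polyT by (subst sum.atMost_shift) simp
    then show ?thesis
      using True \<open>B \<ge> 0\<close> d(1) by (simp add: R_def)
  next
    case False
    have "\<exists>s. (if t < c then t < s \<and> s < c else c < s \<and> s < t) \<and>
        g 0 t = (\<Sum>n<Suc q. (g n c / fact n) * (t - c) ^ n) +
          (g (Suc q) s / fact (Suc q)) * (t - c) ^ Suc q"
      by (rule Taylor [where a = c and b = "c + d"])
        (use False t g d in \<open>auto simp: c_def\<close>)
    then obtain s where s: "c < s" "s < t"
        and Taylor: "g 0 t = (\<Sum>n<Suc q. (g n c / fact n) * (t - c) ^ n) +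
          (g (Suc q) s / fact (Suc q)) * (t - c) ^ Suc q"
      using t by (auto split: if_splits)
    have "\<bar>R t\<bar> = \<bar>g (Suc q) s\<bar> / fact (Suc q) * \<bar>t - c\<bar> ^ Suc q"
      unfolding R_def polyT Taylor lessThan_Suc_atMost
      by (simp add: abs_mult power_abs del: power_Suc fact_Suc)
    also have "\<dots> \<le> B * d ^ Suc q"
    proof (intro mult_mono power_mono)
      have "\<bar>g (Suc q) s\<bar> / fact (Suc q) \<le> \<bar>g (Suc q) s\<bar> / 1"
        by (intro divide_left_mono) (auto simp del: fact_Suc)
      also have "\<dots> \<le> B"
        using B [of s] s t d by (auto simp: c_def)
      finally show "\<bar>g (Suc q) s\<bar> / fact (Suc q) \<le> B" .
    qed (use \<open>B \<ge> 0\<close> t in auto)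
    finally show ?thesis .
  qed
  have contg: "continuous_on {c..c + d} (g 0)"
    using g [of 0] d by (intro DERIV_continuous_on) (auto simp: c_def intro: DERIV_subset)
  have contR: "continuous_on {c..c + d} R"
    unfolding R_def by (intro continuous_intros contg)
  have "\<bar>integral {c..c + d} R\<bar> \<le> B * d ^ Suc q * (c + d - c)"
    unfolding real_norm_def [symmetric] using d(1) R by (intro integral_bound contR) auto
  then have int: "\<bar>integral {c..c + d} R\<bar> \<le> B * d ^ (q + 2)"
    by (simp add: mult_ac)
  have "\<bar>nc_weight q \<xi> i j * R (nc_node q \<xi> i j)\<bar> \<le> real q ^ q * (B * d ^ (q + 2))"
    if "j \<le> q" for j
  proof -
    have "\<bar>nc_weight q \<xi> i j\<bar> * \<bar>R (nc_node q \<xi> i j)\<bar> \<le> (real q ^ q * d) * (B * d ^ Suc q)"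
      using nc_weight_bound [OF \<xi> q that] R [of "nc_node q \<xi> i j"]
        nc_node_in_interval [OF \<xi> q that] d
      by (intro mult_mono) (auto simp: c_def)
    then show ?thesis
      by (simp add: abs_mult mult_ac)
  qed
  then have "\<bar>\<Sum>j=0..q. nc_weight q \<xi> i j * R (nc_node q \<xi> i j)\<bar>
      \<le> (\<Sum>j=0..q. real q ^ q * (B * d ^ (q + 2)))"
    by (intro order_trans [OF sum_abs] sum_mono) auto
  then have sum: "\<bar>\<Sum>j=0..q. nc_weight q \<xi> i j * R (nc_node q \<xi> i j)\<bar>
      \<le> real (Suc q) * real q ^ q * (B * d ^ (q + 2))"
    by simp
  have "integral {c..c + d} R = integral {c..c + d} (g 0) - integral {c..c + d} (poly T)"
    unfolding R_def
    by (intro integral_diff integrable_poly integrable_continuous_real contg)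
  also have "integral {c..c + d} (poly T) = (\<Sum>j=0..q. nc_weight q \<xi> i j * poly T (nc_node q \<xi> i j))"
    using nc_exact [OF \<xi> q \<open>degree T \<le> q\<close>] d(2) by (simp add: c_def)
  finally have "integral {c..c + d} (g 0) - (\<Sum>j=0..q. nc_weight q \<xi> i j * g 0 (nc_node q \<xi> i j))
      = integral {c..c + d} R - (\<Sum>j=0..q. nc_weight q \<xi> i j * R (nc_node q \<xi> i j))"
    by (simp add: R_def right_diff_distrib sum_subtractf)
  then have "\<bar>integral {c..c + d} (g 0) - (\<Sum>j=0..q. nc_weight q \<xi> i j * g 0 (nc_node q \<xi> i j))\<bar>
      \<le> B * d ^ (q + 2) + real (Suc q) * real q ^ q * (B * d ^ (q + 2))"
    using int sum by linarith
  also have "\<dots> = (1 + real (Suc q) * real q ^ q) * B * d ^ (q + 2)"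
    by (simp only: ring_distribs mult_ac mult_1)
  also have "d ^ (q + 2) = real q ^ (q + 2) * nc_step q \<xi> i ^ (q + 2)"
    by (simp only: d(3) power_mult_distrib)
  finally show ?thesis
    using d(2) by (simp only: c_def mult_ac)
qed

lemma subdivision_bounds:
  assumes "subdivision a b N \<xi>" and "i \<le> N"
  shows "a \<le> \<xi> i" and "\<xi> i \<le> b"
proof -
  have \<xi>: "\<xi> 0 = a" "\<xi> N = b" and step: "\<And>j. j < N \<Longrightarrow> \<xi> j < \<xi> (Suc j)"
    using assms(1) by (auto simp: subdivision_def)
  have "\<xi> 0 \<le> \<xi> i"
    using assms(2)
  proof (induction i)
    case (Suc i)
    then show ?case
      using step [of i] by simp
  qed simp
  then show "a \<le> \<xi> i"
    using \<xi> by simp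
  have "\<xi> i \<le> \<xi> N"
    using assms(2)
  proof (induction i rule: inc_induct)
    case (step n)
    then show ?case
      using \<open>\<And>j. j < N \<Longrightarrow> \<xi> j < \<xi> (Suc j)\<close> [of n] by simp
  qed simp
  then show "\<xi> i \<le> b"
    using \<xi> by simp
qed

lemma integral_subdivision:
  fixes g :: "real \<Rightarrow> real"
  assumes sub: "subdivision a b N \<xi>" and g: "g integrable_on {a..b}"
  shows "integral {a..b} g = (\<Sum>i<N. integral {\<xi> i..\<xi> (Suc i)} g)"
proof -
  have "integral {a..\<xi> n} g = (\<Sum>i<n. integral {\<xi> i..\<xi> (Suc i)} g)" if "n \<le> N" for n
    using that
  proof (induction n)
    case 0
    then show ?case
      using sub by (simp add: subdivision_def)
  next
    case (Suc n)
    have "g integrable_on {a..\<xi> (Suc n)}"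
      using g subdivision_bounds [OF sub Suc.prems] by (rule_tac integrable_on_subinterval) auto
    then have "integral {a..\<xi> n} g + integral {\<xi> n..\<xi> (Suc n)} g = integral {a..\<xi> (Suc n)} g"
      using sub subdivision_bounds [OF sub, of n] Suc.prems
      by (intro Henstock_Kurzweil_Integration.integral_combine) (auto simp: subdivision_def less_imp_le)
    with Suc show ?case
      by simp
  qed
  from this [of N] show ?thesis
    using sub by (simp add: subdivision_def)
qed

text \<open>The derivative of order \<open>q + 1\<close> of the integrand, which governs the rule on every
  subinterval, is of size \<open>1 / \<epsilon> ^ (q + 2)\<close>. It exists because \<open>q + 1\<close> exceeds neither the
  smoothness \<open>m\<close> of \<open>S\<close> nor the smoothness \<open>k\<close> of the kernel.\<close>

lemma quadrature_error:
  assumes S: "continuously_differentiable_on m S {a..b}"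
    and q: "q \<ge> 1" "Suc q \<le> m" "Suc q \<le> k"
  obtains C where "C \<ge> 0" and "\<And>\<epsilon> x N \<xi>. \<epsilon> > 0 \<Longrightarrow> a + \<epsilon> < x \<Longrightarrow> x < b - \<epsilon> \<Longrightarrow> subdivision a b N \<xi> \<Longrightarrow>
    \<bar>integral {a..b} (\<lambda>t. S t * delta m k \<epsilon> (x - t)) - nc_convolution m k q N \<xi> S \<epsilon> x\<bar>
      \<le> C * (\<Sum>j<N. nc_step q \<xi> j ^ (q + 2)) / \<epsilon> ^ (q + 2)"
proof -
  obtain C where C: "\<And>\<epsilon> x t. \<epsilon> > 0 \<Longrightarrow> a + \<epsilon> < x \<Longrightarrow> x < b - \<epsilon> \<Longrightarrow>
      \<bar>integrand_deriv m k a b S \<epsilon> x (Suc q) t\<bar> \<le> C / \<epsilon> ^ Suc (Suc q)"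
    using integrand_deriv_bound [OF S q(2,3)] by blast
  define A where "A = (1 + real (Suc q) * real q ^ q) * real q ^ (q + 2)"
  have "A \<ge> 0"
    by (simp add: A_def)
  show ?thesis
  proof (rule that)
    show "A * \<bar>C\<bar> \<ge> 0"
      using \<open>A \<ge> 0\<close> by simp
    fix \<epsilon> x :: real and N \<xi>
    assume \<epsilon>: "\<epsilon> > 0" "a + \<epsilon> < x" "x < b - \<epsilon>" and sub: "subdivision a b N \<xi>"
    define g where "g = integrand_deriv m k a b S \<epsilon> x"
    have g0: "g 0 = (\<lambda>t. S t * delta m k \<epsilon> (x - t))"
      by (simp add: fun_eq_iff g_def integrand_deriv_0)
    have g: "DERIV (g n) t :> g (Suc n) t" if "n \<le> q" for n t
      unfolding g_def using that q by (intro DERIV_integrand_deriv [OF S \<epsilon>]) auto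
    have B: "\<bar>g (Suc q) t\<bar> \<le> \<bar>C\<bar> / \<epsilon> ^ (q + 2)" for t
    proof -
      have "\<bar>g (Suc q) t\<bar> \<le> C / \<epsilon> ^ (q + 2)"
        using C [OF \<epsilon>, of t] by (simp add: g_def)
      also have "\<dots> \<le> \<bar>C\<bar> / \<epsilon> ^ (q + 2)"
        using \<epsilon>(1) by (intro divide_right_mono) auto
      finally show ?thesis .
    qed
    have "continuous_on {a..b} (g 0)"
      using g [of 0] by (intro DERIV_continuous_on) (auto intro: DERIV_subset)
    then have "integral {a..b} (g 0) = (\<Sum>i<N. integral {\<xi> i..\<xi> (Suc i)} (g 0))"
      by (intro integral_subdivision [OF sub] integrable_continuous_real)
    moreover have "nc_convolution m k q N \<xi> S \<epsilon> x
        = (\<Sum>i<N. \<Sum>j=0..q. nc_weight q \<xi> i j * g 0 (nc_node q \<xi> i j))"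
      by (simp add: nc_convolution_def g0 mult.assoc)
    ultimately have "\<bar>integral {a..b} (g 0) - nc_convolution m k q N \<xi> S \<epsilon> x\<bar>
        \<le> (\<Sum>i<N. \<bar>integral {\<xi> i..\<xi> (Suc i)} (g 0) -
          (\<Sum>j=0..q. nc_weight q \<xi> i j * g 0 (nc_node q \<xi> i j))\<bar>)"
      by (simp add: sum_subtractf [symmetric] sum_abs)
    also have "\<dots> \<le> (\<Sum>i<N. A * (\<bar>C\<bar> / \<epsilon> ^ (q + 2)) * nc_step q \<xi> i ^ (q + 2))"
      unfolding A_def using sub
      by (intro sum_mono nc_error q(1) g B) (auto simp: subdivision_def)
    also have "\<dots> = A * \<bar>C\<bar> * (\<Sum>j<N. nc_step q \<xi> j ^ (q + 2)) / \<epsilon> ^ (q + 2)"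
      by (simp add: sum_distrib_left sum_divide_distrib)
    finally show "\<bar>integral {a..b} (\<lambda>t. S t * delta m k \<epsilon> (x - t)) -
        nc_convolution m k q N \<xi> S \<epsilon> x\<bar>
        \<le> A * \<bar>C\<bar> * (\<Sum>j<N. nc_step q \<xi> j ^ (q + 2)) / \<epsilon> ^ (q + 2)"
      unfolding g0 .
  qed
qed


section \<open>Balancing the two errors\<close>

theorem proposition2p2:
  fixes S :: "real \<Rightarrow> real" and a b :: real and m k q :: nat
    and F :: "'i filter" and N :: "'i \<Rightarrow> nat" and \<xi> :: "'i \<Rightarrow> nat \<Rightarrow> real"
    and \<epsilon> x :: "'i \<Rightarrow> real"
  assumes "integrable lebesgue S"
    and "a < b"
    and "continuously_differentiable_on m S {a..b}"
    and "\<forall>t\<in>{a<..<b}. nth_deriv_on {a..b} m S differentiable (at t)"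
    and "bounded (nth_deriv_on {a..b} (m + 1) S ` {a<..<b})"
    and "m \<ge> 2" and "k \<ge> 2" and "q \<ge> 1" and "q \<le> min m k - 1"
    and "\<forall>\<^sub>F i in F. subdivision a b (N i) (\<xi> i)"
    and "\<forall>\<^sub>F i in F. \<epsilon> i > 0"
    and "\<forall>\<^sub>F i in F. x i \<in> {a + \<epsilon> i<..<b - \<epsilon> i}"
    and "\<epsilon> \<in> \<Theta>[F](\<lambda>i. (\<Sum>j<N i. nc_step q (\<xi> i) j ^ (q + 2)) powr (1 / real (m + q + 3)))"
  shows "(\<lambda>i. S (x i) - nc_convolution m k q (N i) (\<xi> i) S (\<epsilon> i) (x i)) \<in> O[F](\<lambda>i. \<epsilon> i ^ (m + 1))"
proof -
  let ?H = "\<lambda>i. \<Sum>j<N i. nc_step q (\<xi> i) j ^ (q + 2)"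
  have q: "Suc q \<le> m" "Suc q \<le> k"
    using assms(6-9) by auto
  obtain C where C: "\<And>\<epsilon> x. \<epsilon> > 0 \<Longrightarrow> a + \<epsilon> < x \<Longrightarrow> x < b - \<epsilon> \<Longrightarrow>
      \<bar>S x - integral {a..b} (\<lambda>t. S t * delta m k \<epsilon> (x - t))\<bar> \<le> C * \<epsilon> ^ Suc m"
    using regularisation_error [OF assms(3)] assms(4,5) by (metis Suc_eq_plus1)
  obtain C' where "C' \<ge> 0"
    and C': "\<And>\<epsilon> x N \<xi>. \<epsilon> > 0 \<Longrightarrow> a + \<epsilon> < x \<Longrightarrow> x < b - \<epsilon> \<Longrightarrow> subdivision a b N \<xi> \<Longrightarrow>
      \<bar>integral {a..b} (\<lambda>t. S t * delta m k \<epsilon> (x - t)) - nc_convolution m k q N \<xi> S \<epsilon> x\<bar>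
        \<le> C' * (\<Sum>j<N. nc_step q \<xi> j ^ (q + 2)) / \<epsilon> ^ (q + 2)"
    using quadrature_error [OF assms(3,8) q] by blast
  \<comment> \<open>The lower bound on \<open>\<epsilon>\<close> keeps the kernel wide enough to be resolved by the subdivision:
    it bounds the sum \<open>?H\<close> by a multiple of \<open>\<epsilon> ^ (m + q + 3)\<close>, of which the quadrature error
    loses \<open>\<epsilon> ^ (q + 2)\<close>.\<close>
  have "(\<lambda>i. ?H i powr (1 / real (m + q + 3))) \<in> O[F](\<epsilon>)"
    using assms(13) by (simp add: bigtheta_def bigomega_iff_bigo)
  then obtain c where c: "c > 0"
    and bound: "\<forall>\<^sub>F i in F. norm (?H i powr (1 / real (m + q + 3))) \<le> c * norm (\<epsilon> i)"
    by (elim landau_o.bigE)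
  have "\<forall>\<^sub>F i in F. norm (S (x i) - nc_convolution m k q (N i) (\<xi> i) S (\<epsilon> i) (x i))
      \<le> (C + C' * c ^ (m + q + 3)) * norm (\<epsilon> i ^ (m + 1))"
    using assms(10-12) bound
  proof eventually_elim
    case (elim i)
    define e where "e = \<epsilon> i"
    have e: "e > 0" "a + e < x i" "x i < b - e"
      using elim by (auto simp: e_def)
    have "?H i \<ge> 0"
      using elim(1)
      by (intro sum_nonneg zero_le_power) (auto simp: nc_step_def subdivision_def less_imp_le)
    then have "?H i = (?H i powr (1 / real (m + q + 3))) ^ (m + q + 3)"
      by (cases "?H i = 0") (auto simp: powr_powr powr_realpow [symmetric] simp del: of_nat_add)
    also have "\<dots> \<le> (c * e) ^ (m + q + 3)"
      using elim e by (intro power_mono) (auto simp: e_def)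
    also have "\<dots> = c ^ (m + q + 3) * (e ^ (m + 1) * e ^ (q + 2))"
      unfolding power_mult_distrib power_add [symmetric]
      by (intro arg_cong2 [where f = "(*)"] arg_cong2 [where f = "(^)"]) simp_all
    finally have H: "?H i / e ^ (q + 2) \<le> c ^ (m + q + 3) * e ^ (m + 1)"
      using e(1) by (subst pos_divide_le_eq) (simp_all only: zero_less_power mult.assoc)
    have "C' * ?H i / e ^ (q + 2) \<le> C' * (c ^ (m + q + 3) * e ^ (m + 1))"
      using mult_left_mono [OF H \<open>C' \<ge> 0\<close>] by simp
    then have "\<bar>integral {a..b} (\<lambda>t. S t * delta m k e (x i - t)) -
        nc_convolution m k q (N i) (\<xi> i) S e (x i)\<bar> \<le> C' * (c ^ (m + q + 3) * e ^ (m + 1))"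
      using C' [OF e elim(1)] by linarith
    moreover have "\<bar>S (x i) - integral {a..b} (\<lambda>t. S t * delta m k e (x i - t))\<bar> \<le> C * e ^ (m + 1)"
      using C [OF e] by simp
    ultimately have "\<bar>S (x i) - nc_convolution m k q (N i) (\<xi> i) S e (x i)\<bar>
        \<le> C * e ^ (m + 1) + C' * (c ^ (m + q + 3) * e ^ (m + 1))"
      by linarith
    then show ?case
      using e(1) by (simp only: e_def [symmetric] real_norm_def distrib_right mult.assoc) simp
  qed
  then show ?thesis
    by (rule bigoI)
qed

end
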